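(* Let $(X,\mathcal{B})$ be an $\mathbf{S}^*$ ball space and $f:X\to X$ a function. 1) Assume that every ball in $\mathcal{B}$ contains a fixed point of $f$ or a smaller ball (a ball in $\mathcal{B}$ properly contained in it). Then every ball in $\mathcal{B}$ contains a fixed point, and $(\mathrm{Fix}(f),\mathcal{B}\cap\mathrm{Fix}(f))$ is an $\mathbf{S}^*$ ball space. 2) Assume that $\mathcal{B}$ contains an $f$-closed ball and every $f$-closed ball in $\mathcal{B}$ contains a fixed point of $f$ or a smaller $f$-closed ball (an $f$-closed ball in $\mathcal{B}$ properly contained in it). Then every $f$-closed ball in $\mathcal{B}$ contains a fixed point, and $(\mathrm{Fix}(f),\mathcal{B}^f\cap\mathrm{Fix}(f))$ is an $\mathbf{S}^*$ ball space.
   Context: A ball space $(X,\mathcal{B})$ consists of a nonempty set $X$ and a nonempty family $\mathcal{B}$ of nonempty subsets of $X$, called balls. A centered system of balls is a nonempty collection of balls such that the intersection of any finite number of balls in the collection is nonempty. $(X,\mathcal{B})$ is an $\mathbf{S}^*$ ball space if the intersection of each centered system of balls is a ball. For $f:X\to X$, a subset $S\subseteq X$ is $f$-closed if $f(S)\subseteq S$; $\mathcal{B}^f$ denotes the collection of all $f$-closed balls in $\mathcal{B}$; $\mathrm{Fix}(f)$ is the set of all fixed points of $f$. For a collection $\mathcal{C}$ of subsets of $X$ and $Y\subseteq X$, $\mathcal{C}\cap Y:=\{B\cap Y\mid B\in\mathcal{C}\}\setminus\{\emptyset\}$. *)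

theory Defs
  imports "HOL-Library.FuncSet"
begin

definition ball_space :: "'a set \<Rightarrow> 'a set set \<Rightarrow> bool" where
  "ball_space X \<B> \<longleftrightarrow> X \<noteq> {} \<and> \<B> \<noteq> {} \<and> (\<forall>B\<in>\<B>. B \<subseteq> X \<and> B \<noteq> {})"

definition centered_system :: "'a set set \<Rightarrow> 'a set set \<Rightarrow> bool" where
  "centered_system \<B> \<C> \<longleftrightarrow>
     \<C> \<noteq> {} \<and> \<C> \<subseteq> \<B> \<and> (\<forall>\<F>. finite \<F> \<longrightarrow> \<F> \<noteq> {} \<longrightarrow> \<F> \<subseteq> \<C> \<longrightarrow> \<Inter>\<F> \<noteq> {})"

definition S_star_ball_space :: "'a set \<Rightarrow> 'a set set \<Rightarrow> bool" where
  "S_star_ball_space X \<B> \<longleftrightarrow>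
     ball_space X \<B> \<and> (\<forall>\<C>. centered_system \<B> \<C> \<longrightarrow> \<Inter>\<C> \<in> \<B>)"

text \<open>The ambient set is a set rather than a type, so that the set of fixed points can
  itself carry a ball space; a self-map of \<open>X\<close> is a function with \<open>f \<in> X \<rightarrow> X\<close>,
  whose values outside \<open>X\<close> play no role.\<close>

definition Fix :: "'a set \<Rightarrow> ('a \<Rightarrow> 'a) \<Rightarrow> 'a set" where
  "Fix X f = {x \<in> X. f x = x}"

definition f_closed :: "('a \<Rightarrow> 'a) \<Rightarrow> 'a set \<Rightarrow> bool" where
  "f_closed f S \<longleftrightarrow> f ` S \<subseteq> S"

definition closed_balls :: "'a set set \<Rightarrow> ('a \<Rightarrow> 'a) \<Rightarrow> 'a set set" where
  "closed_balls \<B> f = {B \<in> \<B>. f_closed f B}"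

definition restrict_family :: "'a set set \<Rightarrow> 'a set \<Rightarrow> 'a set set" where
  "restrict_family \<C> Y = {B \<inter> Y | B. B \<in> \<C>} - {{}}"

end

theory Submission
  imports Defs
begin

text \<open>Both parts are instances of one statement about an \<open>S\<^sup>*\<close> ball space
  \<open>(X, \<B>)\<close> and a target set \<open>Y\<close>: if every ball meets \<open>Y\<close> or contains a smaller ball,
  then every ball meets \<open>Y\<close> and \<open>\<B>\<close> traces an \<open>S\<^sup>*\<close> ball space on \<open>Y\<close>. The first
  half is Zorn's lemma: intersections of nests of balls are balls, so each ball contains a
  minimal ball, which has no smaller ball and hence must meet \<open>Y\<close>
  (\<open>every_ball_meets\<close>). For the second half, a centered system of traces lifts to the
  centered system of all balls having these traces; its intersection is a ball, and so
  meets \<open>Y\<close> by the first half, which makes the trace of this ball a ball again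
  (\<open>S_star_trace\<close>).

  The first part of the theorem takes for \<open>Y\<close> the set of fixed points. The second does the
  same with the family of \<open>f\<close>-closed balls, which is again \<open>S\<^sup>*\<close> because
  intersections of \<open>f\<close>-closed sets are \<open>f\<close>-closed (\<open>S_star_closed_balls\<close>).\<close>

lemma S_star_imp_ball_space:
  "S_star_ball_space X \<B> \<Longrightarrow> ball_space X \<B>"
  by (simp add: S_star_ball_space_def)

lemma S_star_Inter:
  "S_star_ball_space X \<B> \<Longrightarrow> centered_system \<B> \<C> \<Longrightarrow> \<Inter>\<C> \<in> \<B>"
  by (simp add: S_star_ball_space_def)

text \<open>A nonempty finite subset of a nest has its least element as intersection, and this
  element is a ball, hence nonempty.\<close>
lemma centered_system_chain:
  assumes "ball_space X \<B>" "\<C> \<subseteq> \<B>" "\<C> \<noteq> {}"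
    and chain: "\<And>A B. A \<in> \<C> \<Longrightarrow> B \<in> \<C> \<Longrightarrow> A \<subseteq> B \<or> B \<subseteq> A"
  shows "centered_system \<B> \<C>"
  unfolding centered_system_def
proof (intro conjI allI impI)
  fix \<F> assume "finite \<F>" "\<F> \<noteq> {}" "\<F> \<subseteq> \<C>"
  then have "\<Inter>\<F> \<in> \<C>"
  proof (induction \<F> rule: finite_ne_induct)
    case (insert A \<F>)
    then have "A \<inter> \<Inter>\<F> = A \<or> A \<inter> \<Inter>\<F> = \<Inter>\<F>"
      using chain[of A "\<Inter>\<F>"] by blast
    with insert show ?case by auto
  qed simp
  with assms(1,2) show "\<Inter>\<F> \<noteq> {}"
    unfolding ball_space_def by blast
qed (use assms in auto)

lemma ex_minimal_ball_below:
  assumes S: "S_star_ball_space X \<B>" and "B \<in> \<B>"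
  obtains M where "M \<in> \<B>" "M \<subseteq> B" "\<not> (\<exists>B'\<in>\<B>. B' \<subset> M)"
proof -
  define \<A> where "\<A> = {A \<in> \<B>. A \<subseteq> B}"
  have "\<exists>M\<in>\<A>. \<forall>A\<in>\<A>. M \<supseteq> A \<longrightarrow> A = M"
  proof (rule predicate_Zorn)
    show "partial_order_on \<A> (relation_of (\<supseteq>) \<A>)"
      by (rule partial_order_on_relation_ofI) auto
  next
    fix \<C> assume \<C>: "\<C> \<in> Chains (relation_of (\<supseteq>) \<A>)"
    show "\<exists>L\<in>\<A>. \<forall>A\<in>\<C>. A \<supseteq> L"
    proof (cases "\<C> = {}")
      case True
      with \<open>B \<in> \<B>\<close> show ?thesis by (auto simp: \<A>_def)
    next
      case False
      from \<C> have sub: "\<C> \<subseteq> \<A>" and "\<And>A B. A \<in> \<C> \<Longrightarrow> B \<in> \<C> \<Longrightarrow> A \<subseteq> B \<or> B \<subseteq> A"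
        by (auto simp: Chains_def relation_of_def)
      then have "centered_system \<B> \<C>"
        using S_star_imp_ball_space[OF S] False
        by (intro centered_system_chain) (auto simp: \<A>_def)
      then have "\<Inter>\<C> \<in> \<B>" by (rule S_star_Inter[OF S])
      with sub False have "\<Inter>\<C> \<in> \<A>" by (auto simp: \<A>_def)
      then show ?thesis by blast
    qed
  qed
  then obtain M where "M \<in> \<A>" and min: "\<And>A. A \<in> \<A> \<Longrightarrow> A \<subseteq> M \<Longrightarrow> A = M"
    by blast
  show thesis
  proof (rule that)
    show "M \<in> \<B>" "M \<subseteq> B" using \<open>M \<in> \<A>\<close> by (auto simp: \<A>_def)
    then show "\<not> (\<exists>B'\<in>\<B>. B' \<subset> M)" using min by (fastforce simp: \<A>_def)
  qed
qed

text \<open>A minimal ball has only the first alternative of the hypothesis left.\<close>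
lemma every_ball_meets:
  assumes "S_star_ball_space X \<B>"
    and "\<forall>B\<in>\<B>. (\<exists>x\<in>B. x \<in> Y) \<or> (\<exists>B'\<in>\<B>. B' \<subset> B)"
    and "B \<in> \<B>"
  shows "\<exists>x\<in>B. x \<in> Y"
proof -
  obtain M where "M \<in> \<B>" "M \<subseteq> B" "\<not> (\<exists>B'\<in>\<B>. B' \<subset> M)"
    by (rule ex_minimal_ball_below[OF assms(1,3)])
  with assms(2) show ?thesis by blast
qed

text \<open>The trace of an intersection of balls is the intersection of their traces, so
  centeredness passes from traces to balls. That all balls meet \<open>Y\<close> is what keeps the
  resulting trace from being empty, hence from being discarded.\<close>
lemma S_star_trace:
  assumes S: "S_star_ball_space X \<B>"
    and meets: "\<forall>B\<in>\<B>. \<exists>x\<in>B. x \<in> Y"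
  shows "S_star_ball_space Y (restrict_family \<B> Y)"
  unfolding S_star_ball_space_def
proof (intro conjI allI impI)
  from S obtain B where "B \<in> \<B>"
    by (auto simp: S_star_ball_space_def ball_space_def)
  with meets show "ball_space Y (restrict_family \<B> Y)"
    unfolding ball_space_def restrict_family_def by blast
next
  fix \<C> assume \<C>: "centered_system (restrict_family \<B> Y) \<C>"
  define \<D> where "\<D> = {B \<in> \<B>. B \<inter> Y \<in> \<C>}"
  have traces: "\<C> = (\<lambda>B. B \<inter> Y) ` \<D>"
    using \<C> by (auto simp: centered_system_def restrict_family_def \<D>_def)
  have "\<C> \<noteq> {}" using \<C> by (simp add: centered_system_def)
  then have "\<D> \<noteq> {}" by (simp add: traces)
  have "centered_system \<B> \<D>"
    unfolding centered_system_def
  proof (intro conjI allI impI)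
    fix \<F> assume \<F>: "finite \<F>" "\<F> \<noteq> {}" "\<F> \<subseteq> \<D>"
    then have "finite ((\<lambda>B. B \<inter> Y) ` \<F>)" "(\<lambda>B. B \<inter> Y) ` \<F> \<noteq> {}"
        "(\<lambda>B. B \<inter> Y) ` \<F> \<subseteq> \<C>"
      by (auto simp: traces)
    then have "(\<Inter>B\<in>\<F>. B \<inter> Y) \<noteq> {}"
      using \<C> unfolding centered_system_def by blast
    then show "\<Inter>\<F> \<noteq> {}" by blast
  qed (use \<open>\<D> \<noteq> {}\<close> in \<open>auto simp: \<D>_def\<close>)
  then have ball: "\<Inter>\<D> \<in> \<B>" by (rule S_star_Inter[OF S])
  moreover have "\<Inter>\<C> = \<Inter>\<D> \<inter> Y"
    using \<open>\<D> \<noteq> {}\<close> by (auto simp: traces)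
  moreover have "\<Inter>\<D> \<inter> Y \<noteq> {}" using ball meets by blast
  ultimately show "\<Inter>\<C> \<in> restrict_family \<B> Y"
    by (auto simp: restrict_family_def)
qed

lemma S_star_closed_balls:
  assumes S: "S_star_ball_space X \<B>" and ne: "closed_balls \<B> f \<noteq> {}"
  shows "S_star_ball_space X (closed_balls \<B> f)"
  unfolding S_star_ball_space_def
proof (intro conjI allI impI)
  show "ball_space X (closed_balls \<B> f)"
    using S_star_imp_ball_space[OF S] ne by (auto simp: ball_space_def closed_balls_def)
next
  fix \<C> assume \<C>: "centered_system (closed_balls \<B> f) \<C>"
  then have "centered_system \<B> \<C>"
    by (auto simp: centered_system_def closed_balls_def)
  then have "\<Inter>\<C> \<in> \<B>" by (rule S_star_Inter[OF S])
  moreover have "f_closed f (\<Inter>\<C>)"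
    using \<C> unfolding centered_system_def closed_balls_def f_closed_def by blast
  ultimately show "\<Inter>\<C> \<in> closed_balls \<B> f" by (simp add: closed_balls_def)
qed

theorem theorem6p8:
  fixes X :: "'a set" and \<B> :: "'a set set" and f :: "'a \<Rightarrow> 'a"
  assumes "S_star_ball_space X \<B>"
    and "f \<in> X \<rightarrow> X"
  shows "((\<forall>B\<in>\<B>. (\<exists>x\<in>B. x \<in> Fix X f) \<or> (\<exists>B'\<in>\<B>. B' \<subset> B)) \<longrightarrow>
           (\<forall>B\<in>\<B>. \<exists>x\<in>B. x \<in> Fix X f) \<and>
           S_star_ball_space (Fix X f) (restrict_family \<B> (Fix X f)))
       \<and> (closed_balls \<B> f \<noteq> {} \<and>
          (\<forall>B\<in>closed_balls \<B> f.
             (\<exists>x\<in>B. x \<in> Fix X f) \<or> (\<exists>B'\<in>closed_balls \<B> f. B' \<subset> B)) \<longrightarrow>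
           (\<forall>B\<in>closed_balls \<B> f. \<exists>x\<in>B. x \<in> Fix X f) \<and>
           S_star_ball_space (Fix X f) (restrict_family (closed_balls \<B> f) (Fix X f)))"
proof (intro conjI[of "_ \<longrightarrow> _" "_ \<longrightarrow> _"] impI)
  assume "\<forall>B\<in>\<B>. (\<exists>x\<in>B. x \<in> Fix X f) \<or> (\<exists>B'\<in>\<B>. B' \<subset> B)"
  then have "\<forall>B\<in>\<B>. \<exists>x\<in>B. x \<in> Fix X f"
    using every_ball_meets[OF assms(1)] by blast
  with S_star_trace[OF assms(1)]
  show "(\<forall>B\<in>\<B>. \<exists>x\<in>B. x \<in> Fix X f) \<and>
      S_star_ball_space (Fix X f) (restrict_family \<B> (Fix X f))"
    by blast
next
  assume *: "closed_balls \<B> f \<noteq> {} \<and>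
      (\<forall>B\<in>closed_balls \<B> f.
         (\<exists>x\<in>B. x \<in> Fix X f) \<or> (\<exists>B'\<in>closed_balls \<B> f. B' \<subset> B))"
  then have S: "S_star_ball_space X (closed_balls \<B> f)"
    using S_star_closed_balls[OF assms(1)] by blast
  from * have "\<forall>B\<in>closed_balls \<B> f. \<exists>x\<in>B. x \<in> Fix X f"
    using every_ball_meets[OF S] by blast
  with S_star_trace[OF S]
  show "(\<forall>B\<in>closed_balls \<B> f. \<exists>x\<in>B. x \<in> Fix X f) \<and>
      S_star_ball_space (Fix X f) (restrict_family (closed_balls \<B> f) (Fix X f))"
    by blast
qed

end
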